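(* Let $X$ be a topological space and $\ell$ a kernel on $X$ satisfying: (Q0) for any $m$ distinct points $\lambda_1,\dots,\lambda_m\in X$, the kernel functions $\ell_{\lambda_1},\dots,\ell_{\lambda_m}$ are linearly independent; (Q1) $\ell:X\times X\to\mathbb{C}$ is continuous; (Q2) if $\{\lambda_i\}\subset X$ satisfies $\|\ell_{\lambda_i}\|\to\infty$, then $\|\ell_{\lambda_i}\|^{-1}\ell(\lambda_i,\mu)\to0$ for every $\mu\in X$; (Q3) every sequence $\{\lambda_i\}\subset X$ either satisfies $\|\ell_{\lambda_i}\|\to\infty$ or has a subsequence converging to a point of $X$. Then the following are equivalent: (i) $\ell$ has the automatic separation property; (ii) for every $n\ge3$ and every sequence $\{\lambda_i\}$ weakly separated by $\ell$ that can be written as $\{\lambda_i\}=\bigcup_{j\ge1}\bigcup_{k=1}^n\{\mu^k_j\}$ with $\|\ell_{\mu^k_j}\|\to\infty$ as $j\to\infty$ for each $1\le k\le n$, there is a subsequence $\{m_j\}$ such that $\bigcup_{j\ge1}\bigcup_{k=1}^n\{\mu^k_{m_j}\}$ is an interpolating sequence for $\mathcal{H}_\ell$.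
   Context: A kernel on $X$ is a positive semi-definite function $\ell:X\times X\to\mathbb{C}$; $\mathcal{H}_\ell$ its reproducing kernel Hilbert space, $\ell_w=\ell(\cdot,w)$, $\|\ell_w\|^2=\ell(w,w)$, $\hat\ell_w=\ell_w/\|\ell_w\|$, $d_\ell(z,w)=\sqrt{1-|\langle\hat\ell_z,\hat\ell_w\rangle|^2}$. A sequence $\{\lambda_i\}$ is weakly separated by $\ell$ if $d_\ell(\lambda_i,\lambda_j)\ge\epsilon>0$ for all $i\ne j$; for $n\ge2$ it is $n$-weakly separated by $\ell$ if there is $\epsilon>0$ such that for every $n$-point subset $\{\mu_1,\dots,\mu_n\}$ of it, $\mathrm{dist}(\hat\ell_{\mu_1},\mathrm{span}\{\hat\ell_{\mu_2},\dots,\hat\ell_{\mu_n}\})\ge\epsilon$. $\ell$ has the automatic separation property if every sequence weakly separated by $\ell$ is $n$-weakly separated by $\ell$ for every $n\ge3$. A sequence $\{\lambda_i\}$ is interpolating for $\mathcal{H}_\ell$ if the map $f\mapsto (f(\lambda_i)/\|\ell_{\lambda_i}\|)_i$ maps $\mathcal{H}_\ell$ onto $\ell^2$ (equivalently, $\{\hat\ell_{\lambda_i}\}$ is a Riesz sequence). *)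

theory Defs
  imports "HOL-Analysis.Analysis"
begin

text \<open>Kernels are treated through their Gram data: in the RKHS of l one has
  <l_w, l_z> = l z w, hence all Hilbert-space quantities involving finite
  combinations of kernel functions are expressed via l.\<close>

definition kernel :: "('a \<Rightarrow> 'a \<Rightarrow> complex) \<Rightarrow> bool" where
  "kernel l \<longleftrightarrow> (\<forall>F c. finite F \<longrightarrow>
      (\<Sum>x\<in>F. \<Sum>y\<in>F. cnj (c x) * c y * l x y) \<in> \<real> \<and>
      Re (\<Sum>x\<in>F. \<Sum>y\<in>F. cnj (c x) * c y * l x y) \<ge> 0)"

definition knorm :: "('a \<Rightarrow> 'a \<Rightarrow> complex) \<Rightarrow> 'a \<Rightarrow> real" where
  "knorm l w = sqrt (Re (l w w))"

text \<open>Norm of the finite combination sum_{x in F} b x * (normalized l_x).\<close>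
definition comb_norm :: "('a \<Rightarrow> 'a \<Rightarrow> complex) \<Rightarrow> 'a set \<Rightarrow> ('a \<Rightarrow> complex) \<Rightarrow> real" where
  "comb_norm l F b = sqrt (Re (\<Sum>x\<in>F. \<Sum>y\<in>F.
      b x * cnj (b y) * l y x / complex_of_real (knorm l x * knorm l y)))"

definition kdist :: "('a \<Rightarrow> 'a \<Rightarrow> complex) \<Rightarrow> 'a \<Rightarrow> 'a \<Rightarrow> real" where
  "kdist l z w = sqrt (1 - (cmod (l z w) / (knorm l z * knorm l w))\<^sup>2)"

text \<open>Distance from hat l_z to span{hat l_x : x in S} (z not in S).\<close>
definition dist_span :: "('a \<Rightarrow> 'a \<Rightarrow> complex) \<Rightarrow> 'a \<Rightarrow> 'a set \<Rightarrow> real" where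
  "dist_span l z S = Inf {comb_norm l (insert z S) b | b. b z = 1}"

definition weakly_separated :: "('a \<Rightarrow> 'a \<Rightarrow> complex) \<Rightarrow> (nat \<Rightarrow> 'a) \<Rightarrow> bool" where
  "weakly_separated l lam \<longleftrightarrow>
     (\<exists>\<epsilon>>0. \<forall>i j. i \<noteq> j \<longrightarrow> kdist l (lam i) (lam j) \<ge> \<epsilon>)"

definition n_weakly_separated :: "('a \<Rightarrow> 'a \<Rightarrow> complex) \<Rightarrow> nat \<Rightarrow> (nat \<Rightarrow> 'a) \<Rightarrow> bool" where
  "n_weakly_separated l n lam \<longleftrightarrow>
     (\<exists>\<epsilon>>0. \<forall>F. F \<subseteq> range lam \<longrightarrow> card F = n \<longrightarrow>
        (\<forall>z\<in>F. dist_span l z (F - {z}) \<ge> \<epsilon>))"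

definition automatic_separation :: "('a \<Rightarrow> 'a \<Rightarrow> complex) \<Rightarrow> bool" where
  "automatic_separation l \<longleftrightarrow>
     (\<forall>lam. weakly_separated l lam \<longrightarrow> (\<forall>n\<ge>3. n_weakly_separated l n lam))"

text \<open>Interpolating set: the normalized kernel functions {hat l_x : x in S} form a
  Riesz sequence.\<close>
definition interpolating :: "('a \<Rightarrow> 'a \<Rightarrow> complex) \<Rightarrow> 'a set \<Rightarrow> bool" where
  "interpolating l S \<longleftrightarrow> (\<exists>A B. 0 < A \<and> 0 < B \<and>
     (\<forall>F a. finite F \<longrightarrow> F \<subseteq> S \<longrightarrow>
        A * (\<Sum>x\<in>F. (cmod (a x))\<^sup>2) \<le> (comb_norm l F a)\<^sup>2 \<and>
        (comb_norm l F a)\<^sup>2 \<le> B * (\<Sum>x\<in>F. (cmod (a x))\<^sup>2)))"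

end

theory Submission
  imports Defs
begin

text \<open>
  A weakly separated sequence cannot have a subsequence converging in the space, so its kernel norms
  tend to infinity and normalized kernel functions become asymptotically orthogonal to any
  fixed finite set of them. By a block perturbation argument, a sparse union of finite blocks is
  therefore a Riesz sequence as soon as the Gram forms of the blocks are uniformly bounded below;
  and \<open>n\<close>-weak separation is exactly such a uniform lower bound for \<open>n\<close>-point sets. Conversely, if
  the bound fails along \<open>n\<close>-point sets \<open>F j\<close>, then along a subsequence each \<open>F j\<close> splits into a fixed
  finite set, whose Gram form is definite by linear independence, and a part escaping to infinity,
  which is bounded below by interpolation along a further subsequence. The two parts are asymptotically
  orthogonal, a contradiction.
\<close>

section \<open>Auxiliary facts on double sums and enumerations\<close>

text \<open>The majorant has rank one, so its double sum is the square of the sum of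
  \<open>a x * c x\<close>, and Cauchy-Schwarz separates coefficients \<open>a\<close> from weights
  \<open>c\<close>. Only the square sum of the weights enters, uniformly in
  \<open>F\<close>.\<close>

lemma double_sum_bound:
  fixes t :: "'a \<Rightarrow> 'a \<Rightarrow> complex" and a c :: "'a \<Rightarrow> real"
  assumes "\<And>x y. x \<in> F \<Longrightarrow> y \<in> F \<Longrightarrow> cmod (t x y) \<le> (a x * c x) * (a y * c y)"
  shows "cmod (\<Sum>x\<in>F. \<Sum>y\<in>F. t x y) \<le> (\<Sum>x\<in>F. (c x)\<^sup>2) * (\<Sum>x\<in>F. (a x)\<^sup>2)"
proof -
  have "cmod (\<Sum>x\<in>F. \<Sum>y\<in>F. t x y) \<le> (\<Sum>x\<in>F. \<Sum>y\<in>F. (a x * c x) * (a y * c y))"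
    by (intro order_trans[OF norm_sum] sum_mono assms)
  also have "\<dots> = (\<Sum>x\<in>F. a x * c x)\<^sup>2"
    by (simp add: power2_eq_square sum_product)
  also have "\<dots> \<le> (\<Sum>x\<in>F. (a x)\<^sup>2) * (\<Sum>x\<in>F. (c x)\<^sup>2)"
    by (rule Cauchy_Schwarz_ineq_sum)
  finally show ?thesis by (simp add: mult.commute)
qed

text \<open>Blocks are indexed by \<open>{1..n}\<close> with repetitions allowed: a bijection from
  \<open>{1..card D}\<close> is extended by sending every further index to the first point.\<close>

lemma ex_image_atLeastAtMost:
  assumes "finite D" "D \<noteq> {}" "card D \<le> n"
  shows "\<exists>f. f ` {1..n} = D"
proof -
  obtain h where h: "bij_betw h {1..card D} D"
    using ex_bij_betw_nat_finite_1[OF assms(1)] by blast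
  have pos: "card D \<ge> 1" using assms by (simp add: Suc_le_eq card_gt_0_iff)
  have "(\<lambda>k. h (if k \<le> card D then k else 1)) ` {1..n} = h ` ((\<lambda>k. if k \<le> card D then k else 1) ` {1..n})"
    by (simp only: image_image)
  also have "(\<lambda>k. if k \<le> card D then k else 1) ` {1..n} = {1..card D}"
    using pos assms(3) by (auto simp: image_iff)
  finally show ?thesis using h by (auto simp: bij_betw_def)
qed

section \<open>Gram forms of a kernel and the reproducing inequality\<close>

locale independent_kernel =
  fixes l :: "'a \<Rightarrow> 'a \<Rightarrow> complex"
  assumes kernel: "kernel l"
    and independent: "finite F \<Longrightarrow> (\<forall>z. (\<Sum>x\<in>F. c x * l z x) = 0) \<Longrightarrow> x \<in> F \<Longrightarrow> c x = 0"
begin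

text \<open>The squared norm, in the reproducing kernel Hilbert space, of the function whose value
  at \<open>z\<close> is the sum of \<open>c y * l z y\<close> over \<open>y\<close> in
  \<open>F\<close>.\<close>

definition form :: "'a set \<Rightarrow> ('a \<Rightarrow> complex) \<Rightarrow> complex" where
  "form F c = (\<Sum>x\<in>F. \<Sum>y\<in>F. cnj (c x) * c y * l x y)"

lemma Im_form: "finite F \<Longrightarrow> Im (form F c) = 0"
  and Re_form_nonneg: "finite F \<Longrightarrow> Re (form F c) \<ge> 0"
  using kernel unfolding kernel_def form_def by (auto simp: complex_is_Real_iff)

lemma diagonal_Im: "Im (l x x) = 0" and diagonal_Re: "Re (l x x) \<ge> 0"
  using Im_form[of "{x}" "\<lambda>_. 1"] Re_form_nonneg[of "{x}" "\<lambda>_. 1"] by (auto simp: form_def)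

text \<open>Polarization: the forms are only assumed to be real and nonnegative. On two points, the
  coefficients 1, 1 settle the imaginary parts and 1, \<open>\<i>\<close> the real parts.\<close>

lemma hermitian: "cnj (l x y) = l y x"
proof (cases "x = y")
  case True
  then show ?thesis by (simp add: complex_eq_iff diagonal_Im)
next
  case False
  have "Im (l x y) + Im (l y x) = 0"
    using Im_form[of "{x, y}" "\<lambda>_. 1"] False by (simp add: form_def diagonal_Im)
  moreover have "Re (l x y) = Re (l y x)"
    using Im_form[of "{x, y}" "\<lambda>z. if z = x then 1 else \<i>"] False
    by (simp add: form_def diagonal_Im)
  ultimately show ?thesis by (simp add: complex_eq_iff)
qed

text \<open>This expands the squared norm of \<open>f + t * l_z\<close>, where \<open>f\<close> is
  the combination with coefficients \<open>c\<close>. The coefficients are added, not replaced,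
  because \<open>z\<close> may already belong to \<open>F\<close>.\<close>

lemma form_add_point:
  assumes "finite F"
  shows "Re (form (insert z F) (\<lambda>x. (if x \<in> F then c x else 0) + (if x = z then t else 0)))
     = Re (form F c) + 2 * Re (cnj t * (\<Sum>x\<in>F. c x * l z x)) + (cmod t)\<^sup>2 * Re (l z z)"
proof -
  let ?G = "insert z F" and ?a = "\<lambda>x. if x \<in> F then c x else 0" and ?e = "\<lambda>x. if x = z then t else 0"
  define w where "w = (\<Sum>x\<in>F. c x * l z x)"
  have G: "finite ?G" using assms by simp
  have "form ?G (\<lambda>x. ?a x + ?e x) = (\<Sum>x\<in>?G. \<Sum>y\<in>?G. cnj (?a x) * ?a y * l x y)
      + (\<Sum>x\<in>?G. \<Sum>y\<in>?G. cnj (?a x) * ?e y * l x y)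
      + (\<Sum>x\<in>?G. \<Sum>y\<in>?G. cnj (?e x) * ?a y * l x y)
      + (\<Sum>x\<in>?G. \<Sum>y\<in>?G. cnj (?e x) * ?e y * l x y)"
    unfolding form_def sum.distrib[symmetric]
    by (intro sum.cong refl) (simp add: algebra_simps)
  also have "(\<Sum>x\<in>?G. \<Sum>y\<in>?G. cnj (?a x) * ?a y * l x y) = form F c"
    unfolding form_def
    by (intro sum.mono_neutral_cong_right G) (auto intro!: sum.mono_neutral_cong_right G)
  also have "(\<Sum>x\<in>?G. \<Sum>y\<in>?G. cnj (?e x) * ?a y * l x y) = cnj t * (\<Sum>y\<in>F. c y * l z y)"
  proof -
    have "(\<Sum>x\<in>?G. \<Sum>y\<in>?G. cnj (?e x) * ?a y * l x y)
        = (\<Sum>x\<in>?G. if x = z then cnj t * (\<Sum>y\<in>?G. ?a y * l z y) else 0)"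
      by (intro sum.cong refl) (simp add: sum_distrib_left mult.assoc)
    also have "\<dots> = cnj t * (\<Sum>y\<in>?G. ?a y * l z y)" using G by simp
    also have "(\<Sum>y\<in>?G. ?a y * l z y) = (\<Sum>y\<in>F. c y * l z y)"
      by (intro sum.mono_neutral_cong_right G) auto
    finally show ?thesis .
  qed
  also have "(\<Sum>x\<in>?G. \<Sum>y\<in>?G. cnj (?a x) * ?e y * l x y) = cnj (cnj t * (\<Sum>y\<in>F. c y * l z y))"
  proof -
    have "(\<Sum>x\<in>?G. \<Sum>y\<in>?G. cnj (?a x) * ?e y * l x y)
        = (\<Sum>x\<in>?G. \<Sum>y\<in>?G. if y = z then cnj (?a x) * t * l x z else 0)"
      by (intro sum.cong refl) auto
    also have "\<dots> = (\<Sum>x\<in>?G. cnj (?a x) * t * l x z)" using G by (simp only: sum.delta) simp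
    also have "\<dots> = (\<Sum>x\<in>F. cnj (c x) * t * l x z)"
      by (intro sum.mono_neutral_cong_right G) auto
    also have "\<dots> = cnj (cnj t * (\<Sum>y\<in>F. c y * l z y))"
      by (simp add: sum_distrib_left hermitian mult_ac)
    finally show ?thesis .
  qed
  also have "(\<Sum>x\<in>?G. \<Sum>y\<in>?G. cnj (?e x) * ?e y * l x y) = cnj t * t * l z z"
  proof -
    have "(\<Sum>x\<in>?G. \<Sum>y\<in>?G. cnj (?e x) * ?e y * l x y)
        = (\<Sum>x\<in>?G. if x = z then \<Sum>y\<in>?G. if y = z then cnj t * t * l z z else 0 else 0)"
      by (intro sum.cong refl) (auto intro!: sum.cong)
    then show ?thesis using G by simp
  qed
  finally have *: "form ?G (\<lambda>x. ?a x + ?e x) = form F c + cnj (cnj t * w) + cnj t * w + cnj t * t * l z z"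
    unfolding w_def .
  have "Re (cnj t * t * l z z) = (cmod t)\<^sup>2 * Re (l z z)"
    by (simp add: mult.commute[of "cnj t"] flip: complex_norm_square of_real_power)
  then show ?thesis unfolding w_def[symmetric] * by simp
qed

text \<open>With \<open>f\<close> the combination of coefficients \<open>c\<close>, this is the
  bound of the value of \<open>f\<close> at \<open>z\<close> by the norm of \<open>f\<close> times
  the norm of \<open>l_z\<close>. It follows from the nonnegativity of a quadratic polynomial in a
  real parameter \<open>s\<close>.\<close>

lemma kernel_Cauchy_Schwarz:
  assumes "finite F"
  shows "(cmod (\<Sum>x\<in>F. c x * l z x))\<^sup>2 \<le> Re (form F c) * Re (l z z)"
proof -
  define w where "w = (\<Sum>x\<in>F. c x * l z x)"
  define L where "L = Re (l z z)"
  define q where "q = Re (form F c)"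
  \<comment> \<open>Subtracting \<open>s * w\<close> times \<open>l_z\<close> makes the cross term
    real. For \<open>L = 0\<close> the polynomial is affine and the chosen \<open>s\<close> makes it
    negative unless \<open>w = 0\<close>; otherwise \<open>s = 1 / L\<close> is its
    minimizer.\<close>
  have *: "0 \<le> q - 2 * s * (cmod w)\<^sup>2 + s\<^sup>2 * (cmod w)\<^sup>2 * L" for s :: real
  proof -
    have e: "cnj (complex_of_real (- s) * w) * w = complex_of_real (- s * (cmod w)\<^sup>2)"
      by (simp add: mult.assoc mult.commute[of "cnj w"] flip: complex_norm_square)
    have "0 \<le> q + 2 * Re (cnj (complex_of_real (- s) * w) * w)
        + (cmod (complex_of_real (- s) * w))\<^sup>2 * L"
      unfolding q_def w_def L_def form_add_point[OF assms, symmetric]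
      by (rule Re_form_nonneg) (simp add: assms)
    then show ?thesis unfolding e
      by (simp add: norm_mult power_mult_distrib)
  qed
  have "L \<ge> 0" using diagonal_Re L_def by simp
  show ?thesis
  proof (cases "L = 0")
    case True
    have "(cmod w)\<^sup>2 = 0"
    proof (rule ccontr)
      assume "(cmod w)\<^sup>2 \<noteq> 0"
      with *[of "(q + 1) / (cmod w)\<^sup>2"] True Re_form_nonneg[OF assms, of c] show False
        by (simp add: q_def)
    qed
    then show ?thesis using True by (simp add: w_def L_def)
  next
    case False
    with *[of "1 / L"] have "0 \<le> q - (cmod w)\<^sup>2 / L"
      by (simp add: power2_eq_square field_simps)
    then show ?thesis using False \<open>L \<ge> 0\<close> unfolding w_def[symmetric] L_def[symmetric] q_def[symmetric]
      by (simp add: field_simps)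
  qed
qed

text \<open>A vanishing diagonal entry would force \<open>l z x = 0\<close> for all \<open>z\<close>
  by the reproducing inequality, contradicting linear independence of a single kernel
  function.\<close>

lemma diagonal_pos: "Re (l x x) > 0"
proof (rule ccontr)
  assume "\<not> Re (l x x) > 0"
  then have "Re (l x x) = 0" using diagonal_Re[of x] by simp
  then have "form {x} (\<lambda>_. 1) = 0" by (simp add: form_def complex_eq_iff diagonal_Im)
  then have "\<forall>z. (\<Sum>y\<in>{x}. 1 * l z y) = 0"
    using kernel_Cauchy_Schwarz[of "{x}" "\<lambda>_. 1"] by simp
  from independent[OF _ this, of x] show False by simp
qed

lemma knorm_pos: "knorm l x > 0"
  by (simp add: knorm_def diagonal_pos)

lemma diagonal_eq: "l x x = complex_of_real ((knorm l x)\<^sup>2)"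
  by (simp add: knorm_def complex_eq_iff diagonal_Re diagonal_Im)

section \<open>The normalized Gram matrix and norms of finite combinations\<close>

definition gram :: "'a \<Rightarrow> 'a \<Rightarrow> complex" where
  "gram x y = l x y / complex_of_real (knorm l x * knorm l y)"

lemma gram_self: "gram x x = 1"
  using knorm_pos[of x] by (simp add: gram_def diagonal_eq power2_eq_square)

lemma cmod_gram_le_1: "cmod (gram x y) \<le> 1"
proof -
  have "(cmod (l x y))\<^sup>2 \<le> Re (l y y) * Re (l x x)"
    using kernel_Cauchy_Schwarz[of "{y}" "\<lambda>_. 1" x] by (simp add: form_def)
  then have "(cmod (l x y))\<^sup>2 \<le> (knorm l x * knorm l y)\<^sup>2"
    by (simp add: diagonal_eq power_mult_distrib mult.commute)
  then have "cmod (l x y) \<le> knorm l x * knorm l y"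
    by (rule power2_le_imp_le) (simp add: knorm_pos less_imp_le)
  then show ?thesis using knorm_pos[of x] knorm_pos[of y]
    by (simp add: gram_def norm_divide norm_mult)
qed

lemma gram_commute: "gram y x = cnj (gram x y)"
  by (simp add: gram_def hermitian mult.commute)

lemma cmod_gram_commute: "cmod (gram y x) = cmod (gram x y)"
  by (subst gram_commute) simp

lemma kdist_eq: "kdist l x y = sqrt (1 - (cmod (gram x y))\<^sup>2)"
  using knorm_pos[of x] knorm_pos[of y] by (simp add: kdist_def gram_def norm_divide norm_mult)

lemma kdist_self: "kdist l x x = 0"
  by (simp add: kdist_eq gram_self)

text \<open>Dividing coefficients by kernel norms turns combinations of normalized kernel functions
  into plain ones, so positivity of \<open>form\<close> carries over to \<open>comb_norm\<close>.
  The two conjugate different indices, hence the swap of sums.\<close>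

lemma Re_form_normalized:
  "Re (form F (\<lambda>x. b x / complex_of_real (knorm l x))) = Re (\<Sum>x\<in>F. \<Sum>y\<in>F. b x * cnj (b y) * gram y x)"
  unfolding form_def gram_def
  by (subst sum.swap) (simp add: field_simps)

lemma comb_norm_sq:
  assumes "finite F"
  shows "(comb_norm l F b)\<^sup>2 = Re (\<Sum>x\<in>F. \<Sum>y\<in>F. b x * cnj (b y) * gram y x)"
proof -
  have "comb_norm l F b = sqrt (Re (\<Sum>x\<in>F. \<Sum>y\<in>F. b x * cnj (b y) * gram y x))"
    unfolding comb_norm_def gram_def by (simp add: mult.commute)
  then show ?thesis
    using Re_form_nonneg[OF assms, of "\<lambda>x. b x / complex_of_real (knorm l x)"]
    by (simp only: Re_form_normalized real_sqrt_pow2)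
qed

lemma comb_norm_nonneg: "finite F \<Longrightarrow> comb_norm l F b \<ge> 0"
  using Re_form_nonneg[of F "\<lambda>x. b x / complex_of_real (knorm l x)"]
  unfolding Re_form_normalized unfolding comb_norm_def gram_def
  by (simp add: mult.commute del: Re_sum)

lemma comb_norm_scale:
  assumes "finite F"
  shows "comb_norm l F (\<lambda>x. t * b x) = cmod t * comb_norm l F b"
proof -
  have "(\<Sum>x\<in>F. \<Sum>y\<in>F. t * b x * cnj (t * b y) * gram y x)
      = complex_of_real ((cmod t)\<^sup>2) * (\<Sum>x\<in>F. \<Sum>y\<in>F. b x * cnj (b y) * gram y x)"
    unfolding sum_distrib_left
    by (intro sum.cong refl) (simp add: complex_norm_square del: of_real_power)
  then have "(comb_norm l F (\<lambda>x. t * b x))\<^sup>2 = (cmod t * comb_norm l F b)\<^sup>2"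
    by (simp add: comb_norm_sq assms power_mult_distrib)
  then show ?thesis
    by (simp add: comb_norm_nonneg assms)
qed

lemma comb_norm_mono_neutral:
  assumes "finite G" "F \<subseteq> G"
  shows "comb_norm l G (\<lambda>x. if x \<in> F then b x else 0) = comb_norm l F b"
proof -
  have "(\<Sum>x\<in>G. \<Sum>y\<in>G. (if x \<in> F then b x else 0) * cnj (if y \<in> F then b y else 0) * gram y x)
      = (\<Sum>x\<in>F. \<Sum>y\<in>F. b x * cnj (b y) * gram y x)"
    using assms by (intro sum.mono_neutral_cong_right) (auto intro!: sum.mono_neutral_cong_right)
  then have "(comb_norm l G (\<lambda>x. if x \<in> F then b x else 0))\<^sup>2 = (comb_norm l F b)\<^sup>2"
    by (simp only: comb_norm_sq assms finite_subset[OF assms(2,1)])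
  then show ?thesis
    using finite_subset[OF assms(2,1)] assms(1) by (simp add: comb_norm_nonneg)
qed

section \<open>Block decompositions of Gram forms\<close>

lemma comb_norm_sq_le_card:
  assumes "finite F"
  shows "(comb_norm l F b)\<^sup>2 \<le> card F * (\<Sum>x\<in>F. (cmod (b x))\<^sup>2)"
proof -
  have "(comb_norm l F b)\<^sup>2 \<le> cmod (\<Sum>x\<in>F. \<Sum>y\<in>F. b x * cnj (b y) * gram y x)"
    unfolding comb_norm_sq[OF assms] by (rule complex_Re_le_cmod)
  also have "\<dots> \<le> (\<Sum>x\<in>F. 1\<^sup>2) * (\<Sum>x\<in>F. (cmod (b x))\<^sup>2)"
    by (rule double_sum_bound)
      (auto simp: norm_mult intro!: mult_left_le cmod_gram_le_1)
  finally show ?thesis by simp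
qed

text \<open>The labels \<open>h\<close> split the Gram matrix into diagonal blocks and a remainder
  \<open>D\<close> of pairs with different labels. Since the entries of \<open>D\<close> are
  dominated by a rank one matrix, \<open>double_sum_bound\<close> controls it.\<close>

lemma comb_norm_sq_blocks:
  fixes h :: "'a \<Rightarrow> nat" and c :: "'a \<Rightarrow> real"
  assumes F: "finite F"
    and off: "\<And>x y. x \<in> F \<Longrightarrow> y \<in> F \<Longrightarrow> h x \<noteq> h y \<Longrightarrow> cmod (gram x y) \<le> c x * c y"
    and c: "\<And>x. x \<in> F \<Longrightarrow> c x \<ge> 0"
  shows "\<bar>(comb_norm l F b)\<^sup>2 - (\<Sum>j\<in>h ` F. (comb_norm l {x \<in> F. h x = j} b)\<^sup>2)\<bar>
     \<le> (\<Sum>x\<in>F. (c x)\<^sup>2) * (\<Sum>x\<in>F. (cmod (b x))\<^sup>2)"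
proof -
  let ?t = "\<lambda>x y. b x * cnj (b y) * gram y x"
  define D where "D = (\<Sum>x\<in>F. \<Sum>y\<in>F. if h x = h y then 0 else ?t x y)"
  have D: "cmod D \<le> (\<Sum>x\<in>F. (c x)\<^sup>2) * (\<Sum>x\<in>F. (cmod (b x))\<^sup>2)"
    unfolding D_def
  proof (rule double_sum_bound)
    fix x y assume xy: "x \<in> F" "y \<in> F"
    show "cmod (if h x = h y then 0 else ?t x y) \<le> cmod (b x) * c x * (cmod (b y) * c y)"
    proof (cases "h x = h y")
      case False
      then have "cmod (b x) * cmod (b y) * cmod (gram y x) \<le> cmod (b x) * cmod (b y) * (c y * c x)"
        using off[of y x] xy by (intro mult_left_mono) auto
      then show ?thesis using False by (simp add: norm_mult mult_ac)
    qed (use c xy in simp)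
  qed
  have "(\<Sum>x\<in>F. \<Sum>y\<in>F. ?t x y)
      = (\<Sum>x\<in>F. \<Sum>y\<in>F. (if h x = h y then ?t x y else 0)) + D"
    unfolding D_def sum.distrib[symmetric] by (intro sum.cong refl) auto
  also have "(\<Sum>x\<in>F. \<Sum>y\<in>F. (if h x = h y then ?t x y else 0))
      = (\<Sum>x\<in>F. \<Sum>y\<in>{y \<in> F. h y = h x}. ?t x y)"
    by (intro sum.cong refl sum.mono_neutral_cong_right) (auto simp: F)
  also have "\<dots> = (\<Sum>j\<in>h ` F. \<Sum>x\<in>{x \<in> F. h x = j}. \<Sum>y\<in>{y \<in> F. h y = h x}. ?t x y)"
    by (rule sum.image_gen[OF F])
  also have "\<dots> = (\<Sum>j\<in>h ` F. \<Sum>x\<in>{x \<in> F. h x = j}. \<Sum>y\<in>{y \<in> F. h y = j}. ?t x y)"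
    by (intro sum.cong refl) auto
  finally have "(comb_norm l F b)\<^sup>2 = (\<Sum>j\<in>h ` F. (comb_norm l {x \<in> F. h x = j} b)\<^sup>2) + Re D"
    by (simp add: comb_norm_sq F)
  then show ?thesis using D abs_Re_le_cmod[of D] by simp
qed

text \<open>A lower bound common to all blocks adds up over the labels; the interaction between
  blocks costs at most the square sum of the weights.\<close>

lemma comb_norm_sq_blocks_lower:
  fixes h :: "'a \<Rightarrow> nat" and c :: "'a \<Rightarrow> real"
  assumes F: "finite F"
    and off: "\<And>x y. x \<in> F \<Longrightarrow> y \<in> F \<Longrightarrow> h x \<noteq> h y \<Longrightarrow> cmod (gram x y) \<le> c x * c y"
    and c: "\<And>x. x \<in> F \<Longrightarrow> c x \<ge> 0"
    and low: "\<And>j. j \<in> h ` F \<Longrightarrow>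
      \<delta> * (\<Sum>x | x \<in> F \<and> h x = j. (cmod (b x))\<^sup>2) \<le> (comb_norm l {x \<in> F. h x = j} b)\<^sup>2"
  shows "(\<delta> - (\<Sum>x\<in>F. (c x)\<^sup>2)) * (\<Sum>x\<in>F. (cmod (b x))\<^sup>2) \<le> (comb_norm l F b)\<^sup>2"
proof -
  have "\<delta> * (\<Sum>x\<in>F. (cmod (b x))\<^sup>2) = (\<Sum>j\<in>h ` F. \<delta> * (\<Sum>x | x \<in> F \<and> h x = j. (cmod (b x))\<^sup>2))"
    by (subst sum.image_gen[OF F, of _ h]) (simp add: sum_distrib_left)
  also have "\<dots> \<le> (\<Sum>j\<in>h ` F. (comb_norm l {x \<in> F. h x = j} b)\<^sup>2)"
    by (intro sum_mono low)
  finally show ?thesis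
    using comb_norm_sq_blocks[OF F off c, of h b] by (simp add: left_diff_distrib)
qed

text \<open>Compactness of the unit sphere of coefficients gives a minimum of the form, and linear
  independence keeps this minimum away from zero.\<close>

lemma finite_lower_bound:
  assumes F: "finite F"
  obtains \<delta> where "\<delta> > 0"
    "\<And>b. \<delta> * (\<Sum>x\<in>F. (cmod (b x))\<^sup>2) \<le> (comb_norm l F b)\<^sup>2"
proof (cases "F = {}")
  case True
  then show ?thesis using that[of 1] by (simp add: comb_norm_def)
next
  case False
  \<comment> \<open>The unit sphere of the coefficients on \<open>F\<close>, realized among all
    functions on \<open>'a\<close>: coordinates in \<open>F\<close> lie in a disc, all others are
    pinned to 0. Being a product of compact sets cut by a closed condition, it is compact in the
    product topology.\<close>
  define K where "K = PiE UNIV (\<lambda>x. if x \<in> F then cball (0::complex) 1 else {0}) \<inter> {b. (\<Sum>x\<in>F. (cmod (b x))\<^sup>2) = 1}"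
  have cont: "continuous_on S (\<lambda>b::'a \<Rightarrow> complex. b x)" for S x
    by (rule continuous_on_product_coordinates[THEN continuous_on_subset]) simp
  have "compactin (product_topology (\<lambda>_. euclidean) UNIV)
      (PiE UNIV (\<lambda>x. if x \<in> F then cball (0::complex) 1 else {0}))"
    by (simp add: compactin_PiE)
  then have "compact (PiE UNIV (\<lambda>x. if x \<in> F then cball (0::complex) 1 else {0}))"
    by (simp add: euclidean_product_topology)
  moreover have "closed {b. (\<Sum>x\<in>F. (cmod (b x))\<^sup>2) = 1}"
    by (intro closed_Collect_eq continuous_intros cont)
  ultimately have "compact K" unfolding K_def by (rule compact_Int_closed)
  obtain x0 where x0: "x0 \<in> F" using False by blast
  have "K \<noteq> {}"
  proof -
    have "(\<Sum>x\<in>F. (cmod (if x = x0 then 1 else 0))\<^sup>2) = (\<Sum>x\<in>F. if x = x0 then 1 else 0)"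
      by (intro sum.cong) auto
    then have "(\<lambda>x. if x = x0 then 1 else 0) \<in> K"
      using F x0 by (auto simp: K_def)
    then show ?thesis by blast
  qed
  moreover have "continuous_on K (\<lambda>b. (comb_norm l F b)\<^sup>2)"
    unfolding comb_norm_sq[OF F] by (intro continuous_intros cont)
  ultimately obtain b0 where b0: "b0 \<in> K" "\<And>b. b \<in> K \<Longrightarrow> (comb_norm l F b0)\<^sup>2 \<le> (comb_norm l F b)\<^sup>2"
    using continuous_attains_inf[OF \<open>compact K\<close>] by metis
  define \<delta> where "\<delta> = (comb_norm l F b0)\<^sup>2"
  \<comment> \<open>A minimizer of norm 0 gives a combination that vanishes at every point by the
    reproducing inequality.\<close>
  have "\<delta> \<noteq> 0"
  proof
    assume "\<delta> = 0"
    let ?c = "\<lambda>x. b0 x / complex_of_real (knorm l x)"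
    have "Re (form F ?c) = 0"
      using \<open>\<delta> = 0\<close> by (simp only: Re_form_normalized \<delta>_def comb_norm_sq[OF F])
    then have "\<forall>z. (\<Sum>x\<in>F. ?c x * l z x) = 0"
      using kernel_Cauchy_Schwarz[OF F, of ?c] by simp
    then have "?c x = 0" if "x \<in> F" for x using independent[OF F, of ?c] that by blast
    then have "b0 x = 0" if "x \<in> F" for x using that knorm_pos[of x] by force
    then show False using b0(1) by (simp add: K_def)
  qed
  then have "\<delta> > 0" unfolding \<delta>_def by (simp add: zero_less_power2)
  moreover have "\<delta> * (\<Sum>x\<in>F. (cmod (b x))\<^sup>2) \<le> (comb_norm l F b)\<^sup>2" for b
  proof (cases "(\<Sum>x\<in>F. (cmod (b x))\<^sup>2) = 0")
    case False
    define s where "s = (\<Sum>x\<in>F. (cmod (b x))\<^sup>2)"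
    have s: "s > 0" using False sum_nonneg[of F "\<lambda>x. (cmod (b x))\<^sup>2"] unfolding s_def by force
    \<comment> \<open>Membership in \<open>K\<close> requires both unit norm and the value 0 off
      \<open>F\<close>, hence rescaling together with truncation.\<close>
    define b' where "b' = (\<lambda>x. if x \<in> F then complex_of_real (1 / sqrt s) * b x else 0)"
    have n: "(\<Sum>x\<in>F. (cmod (b' x))\<^sup>2) = 1"
    proof -
      have "(\<Sum>x\<in>F. (cmod (b' x))\<^sup>2) = (\<Sum>x\<in>F. (cmod (b x))\<^sup>2 / s)"
        using s by (intro sum.cong refl) (simp add: b'_def norm_divide norm_mult power_divide)
      also have "\<dots> = 1" using s by (simp add: s_def flip: sum_divide_distrib)
      finally show ?thesis .
    qed
    have "cmod (b' x) \<le> 1" if "x \<in> F" for x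
    proof -
      have "(cmod (b' x))\<^sup>2 \<le> 1\<^sup>2"
        using member_le_sum[OF that, of "\<lambda>x. (cmod (b' x))\<^sup>2"] F n by simp
      then show ?thesis by (rule power2_le_imp_le) simp
    qed
    then have "b' \<in> K" using n by (auto simp: K_def b'_def)
    then have "\<delta> \<le> (comb_norm l F b')\<^sup>2" using b0(2) \<delta>_def by blast
    also have "comb_norm l F b' = comb_norm l F (\<lambda>x. complex_of_real (1 / sqrt s) * b x)"
      unfolding comb_norm_def b'_def by (simp cong: sum.cong)
    also have "\<dots>\<^sup>2 = (comb_norm l F b)\<^sup>2 / s"
      unfolding comb_norm_scale[OF F] using s by (simp add: norm_divide power_divide)
    finally show ?thesis using s by (simp add: s_def[symmetric] field_simps)
  qed (use F in simp)
  ultimately show ?thesis by (rule that)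
qed

section \<open>Uniform lower bounds and n-weak separation\<close>

text \<open>For finite nonempty \<open>F\<close> this says that the least eigenvalue of the
  normalized Gram matrix of \<open>F\<close> is at least \<delta>; unlike distances to spans, it
  behaves well under block perturbation.\<close>

definition gram_ge :: "real \<Rightarrow> 'a set \<Rightarrow> bool" where
  "gram_ge \<delta> F \<longleftrightarrow> (\<forall>b. \<delta> * (\<Sum>x\<in>F. (cmod (b x))\<^sup>2) \<le> (comb_norm l F b)\<^sup>2)"

lemma gram_ge_mono:
  assumes "gram_ge \<delta> F" "\<delta>' \<le> \<delta>"
  shows "gram_ge \<delta>' F"
  unfolding gram_ge_def
proof
  fix b
  have "\<delta>' * (\<Sum>x\<in>F. (cmod (b x))\<^sup>2) \<le> \<delta> * (\<Sum>x\<in>F. (cmod (b x))\<^sup>2)"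
    using assms(2) by (intro mult_right_mono sum_nonneg) auto
  then show "\<delta>' * (\<Sum>x\<in>F. (cmod (b x))\<^sup>2) \<le> (comb_norm l F b)\<^sup>2"
    using assms(1) unfolding gram_ge_def by (meson order_trans)
qed

lemma gram_ge_subset:
  assumes "gram_ge \<delta> G" "F \<subseteq> G" "finite G"
  shows "gram_ge \<delta> F"
  unfolding gram_ge_def
proof
  fix b :: "'a \<Rightarrow> complex"
  let ?b = "\<lambda>x. if x \<in> F then b x else 0"
  have "(\<Sum>x\<in>G. (cmod (?b x))\<^sup>2) = (\<Sum>x\<in>F. (cmod (b x))\<^sup>2)"
    using assms by (intro sum.mono_neutral_cong_right) auto
  then show "\<delta> * (\<Sum>x\<in>F. (cmod (b x))\<^sup>2) \<le> (comb_norm l F b)\<^sup>2"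
    using assms(1) comb_norm_mono_neutral[OF assms(3,2), of b] unfolding gram_ge_def by metis
qed

text \<open>Scaling a combination so that its coefficient at \<open>z\<close> becomes 1 bounds each
  single coefficient by the norm of the combination. Summing the squares over at most
  \<open>n\<close> points costs the factor \<open>n\<close>.\<close>

lemma dist_span_ge_imp_gram_ge:
  assumes F: "finite F" and "\<epsilon> > 0" and d: "\<And>z. z \<in> F \<Longrightarrow> dist_span l z (F - {z}) \<ge> \<epsilon>"
    and n: "card F \<le> n" "n > 0"
  shows "gram_ge (\<epsilon>\<^sup>2 / n) F"
  unfolding gram_ge_def
proof
  fix b
  have coeff: "\<epsilon> * cmod (b z) \<le> comb_norm l F b" if z: "z \<in> F" for z
  proof (cases "b z = 0")
    case False
    have [simp]: "insert z F = F" using z by blast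
    let ?b = "\<lambda>x. inverse (b z) * b x"
    have "dist_span l z (F - {z}) \<le> comb_norm l F ?b"
      unfolding dist_span_def
      by (rule cInf_lower) (use False F z in \<open>auto simp: bdd_below_def intro!: exI[of _ 0] exI[of _ ?b] comb_norm_nonneg\<close>)
    then have "\<epsilon> \<le> inverse (cmod (b z)) * comb_norm l F b"
      using d[OF z] by (simp only: comb_norm_scale[OF F] norm_inverse)
    then show ?thesis using False by (simp add: field_simps)
  qed (simp add: comb_norm_nonneg F)
  have "\<epsilon>\<^sup>2 * (\<Sum>x\<in>F. (cmod (b x))\<^sup>2) = (\<Sum>x\<in>F. (\<epsilon> * cmod (b x))\<^sup>2)"
    by (simp add: sum_distrib_left power_mult_distrib)
  also have "\<dots> \<le> (\<Sum>x\<in>F. (comb_norm l F b)\<^sup>2)"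
    using \<open>\<epsilon> > 0\<close> by (intro sum_mono power_mono coeff) auto
  also have "\<dots> \<le> n * (comb_norm l F b)\<^sup>2"
    using n by (simp add: mult_right_mono)
  finally show "\<epsilon>\<^sup>2 / n * (\<Sum>x\<in>F. (cmod (b x))\<^sup>2) \<le> (comb_norm l F b)\<^sup>2"
    using n by (simp add: field_simps)
qed

text \<open>A competitor for the infimum has coefficient 1 at \<open>z\<close>, so its coefficients
  have square sum at least 1.\<close>

lemma gram_ge_imp_dist_span_ge:
  assumes F: "finite F" and \<delta>: "\<delta> > 0" "gram_ge \<delta> F" and z: "z \<in> F"
  shows "dist_span l z (F - {z}) \<ge> sqrt \<delta>"
  unfolding dist_span_def
proof (rule cInf_greatest)
  show "{comb_norm l (insert z (F - {z})) b |b. b z = 1} \<noteq> {}"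
    by (auto intro!: exI[of _ "\<lambda>_. 1"])
  fix v assume "v \<in> {comb_norm l (insert z (F - {z})) b |b. b z = 1}"
  then obtain b where b: "b z = 1" "v = comb_norm l F b" using z by (auto simp: insert_absorb)
  have "\<delta> * 1 \<le> \<delta> * (\<Sum>x\<in>F. (cmod (b x))\<^sup>2)"
    using member_le_sum[OF z, of "\<lambda>x. (cmod (b x))\<^sup>2"] F b \<delta> by (intro mult_left_mono) auto
  also have "\<dots> \<le> v\<^sup>2" using \<delta> b by (simp add: gram_ge_def)
  finally show "sqrt \<delta> \<le> v"
    using b comb_norm_nonneg[OF F] by (simp add: real_le_lsqrt)
qed

lemma n_weakly_separated_iff_gram_ge:
  assumes "n > 0"
  shows "n_weakly_separated l n lam \<longleftrightarrow>
    (\<exists>\<delta>>0. \<forall>F. F \<subseteq> range lam \<longrightarrow> card F = n \<longrightarrow> gram_ge \<delta> F)"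
proof
  assume "n_weakly_separated l n lam"
  then obtain \<epsilon> where "\<epsilon> > 0" and
    \<epsilon>: "\<And>F z. F \<subseteq> range lam \<Longrightarrow> card F = n \<Longrightarrow> z \<in> F \<Longrightarrow> dist_span l z (F - {z}) \<ge> \<epsilon>"
    unfolding n_weakly_separated_def by blast
  have "gram_ge (\<epsilon>\<^sup>2 / n) F" if "F \<subseteq> range lam" "card F = n" for F
    using that assms \<open>\<epsilon> > 0\<close> \<epsilon> card_ge_0_finite
    by (intro dist_span_ge_imp_gram_ge) auto
  moreover have "\<epsilon>\<^sup>2 / n > 0" using \<open>\<epsilon> > 0\<close> assms by simp
  ultimately show "\<exists>\<delta>>0. \<forall>F. F \<subseteq> range lam \<longrightarrow> card F = n \<longrightarrow> gram_ge \<delta> F" by blast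
next
  assume "\<exists>\<delta>>0. \<forall>F. F \<subseteq> range lam \<longrightarrow> card F = n \<longrightarrow> gram_ge \<delta> F"
  then obtain \<delta> where \<delta>: "\<delta> > 0" "\<And>F. F \<subseteq> range lam \<Longrightarrow> card F = n \<Longrightarrow> gram_ge \<delta> F" by blast
  then have "dist_span l z (F - {z}) \<ge> sqrt \<delta>" if "F \<subseteq> range lam" "card F = n" "z \<in> F" for F z
    using that assms card_ge_0_finite by (intro gram_ge_imp_dist_span_ge) auto
  moreover have "sqrt \<delta> > 0" using \<delta> by simp
  ultimately show "n_weakly_separated l n lam" unfolding n_weakly_separated_def by blast
qed

lemma weakly_separated_inj:
  assumes "weakly_separated l lam"
  shows "inj lam"
proof (rule injI, rule ccontr)
  fix i j assume "lam i = lam j" "i \<noteq> j"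
  then show False using assms kdist_self[of "lam i"] unfolding weakly_separated_def by force
qed

text \<open>Distinct terms of an injective enumeration of \<open>U\<close> are values of
  \<open>lam\<close> at distinct indices. This supplies the weakly separated sequence that the
  interpolation condition asks for.\<close>

lemma weakly_separated_subset:
  assumes "weakly_separated l lam" "infinite U" "U \<subseteq> range lam"
  obtains lam' where "weakly_separated l lam'" "range lam' = U"
proof -
  obtain f :: "nat \<Rightarrow> 'a" where f: "bij_betw f UNIV U"
    using bij_betw_from_nat_into[OF countable_subset[OF assms(3)] assms(2)] by blast
  have *: "kdist l (f i) (f j) \<ge> \<epsilon>"
    if "\<forall>i j. i \<noteq> j \<longrightarrow> kdist l (lam i) (lam j) \<ge> \<epsilon>" "i \<noteq> j" for \<epsilon> i j
  proof -
    have "f i \<noteq> f j" "f i \<in> U" "f j \<in> U"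
      using f that(2) by (auto simp: bij_betw_def inj_def)
    moreover from this obtain p q where "f i = lam p" "f j = lam q" using assms(3) by blast
    ultimately show ?thesis using that(1) by metis
  qed
  have "weakly_separated l f" using assms(1) * unfolding weakly_separated_def by blast
  then show ?thesis using that f by (simp add: bij_betw_def)
qed

text \<open>Block perturbation with two labels and a constant weight: at most \<open>n\<close>
  points of squared weight \<open>\<delta> / (2 * n)\<close> lose no more than half of
  \<delta>.\<close>

lemma gram_ge_far_union:
  assumes fin: "finite J" "finite D" and disj: "J \<inter> D = {}" and card: "card (J \<union> D) \<le> n" "n > 0"
    and \<delta>: "\<delta> > 0" "gram_ge \<delta> J" "gram_ge \<delta> D"
    and far: "\<And>x w. x \<in> D \<Longrightarrow> w \<in> J \<Longrightarrow> cmod (gram x w) \<le> \<delta> / (2 * n)"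
  shows "gram_ge (\<delta> / 2) (J \<union> D)"
proof -
  define h :: "'a \<Rightarrow> nat" where "h x = (if x \<in> J then 0 else 1)" for x
  define c :: "'a \<Rightarrow> real" where "c x = sqrt (\<delta> / (2 * n))" for x
  have [simp]: "(c x)\<^sup>2 = \<delta> / (2 * n)" "c x \<ge> 0" "c x * c y = \<delta> / (2 * n)" for x y
    using \<delta> by (simp_all add: c_def)
  have blk: "{x \<in> J \<union> D. h x = j} = (if j = 0 then J else if j = 1 then D else {})" for j
    using disj by (auto simp: h_def)
  have low: "\<delta> * (\<Sum>x | x \<in> J \<union> D \<and> h x = j. (cmod (b x))\<^sup>2) \<le> (comb_norm l {x \<in> J \<union> D. h x = j} b)\<^sup>2"
    for j b
    unfolding blk using \<delta> by (simp add: gram_ge_def)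
  have off: "cmod (gram x y) \<le> c x * c y" if "x \<in> J \<union> D" "y \<in> J \<union> D" "h x \<noteq> h y" for x y
    using that far[of x y] far[of y x] cmod_gram_commute[of x y] by (auto simp: h_def split: if_splits)
  have "(\<delta> - (\<Sum>x\<in>J \<union> D. (c x)\<^sup>2)) * (\<Sum>x\<in>J \<union> D. (cmod (b x))\<^sup>2) \<le> (comb_norm l (J \<union> D) b)\<^sup>2" for b
    by (rule comb_norm_sq_blocks_lower[where h = h]) (use fin off low in auto)
  then have "gram_ge (\<delta> - (\<Sum>x\<in>J \<union> D. (c x)\<^sup>2)) (J \<union> D)" by (simp add: gram_ge_def)
  moreover have "\<delta> / 2 \<le> \<delta> - (\<Sum>x\<in>J \<union> D. (c x)\<^sup>2)"
  proof -
    have "(\<Sum>x\<in>J \<union> D. (c x)\<^sup>2) = card (J \<union> D) * (\<delta> / (2 * n))" by simp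
    also have "\<dots> \<le> n * (\<delta> / (2 * n))" using card \<delta> by (intro mult_right_mono) auto
    also have "\<dots> = \<delta> / 2" using card by simp
    finally show ?thesis by simp
  qed
  ultimately show ?thesis by (rule gram_ge_mono)
qed

end

section \<open>Kernels on a topological space and points escaping to infinity\<close>

locale proper_kernel = independent_kernel l
  for l :: "'a::topological_space \<Rightarrow> 'a \<Rightarrow> complex" +
  assumes continuous: "continuous_on UNIV (\<lambda>(z, w). l z w)"
    and escaping: "filterlim (\<lambda>i. knorm l (lam i)) at_top sequentially \<Longrightarrow>
        (\<lambda>i. l (lam i) \<mu> / complex_of_real (knorm l (lam i))) \<longlonglongrightarrow> 0"
    and proper: "filterlim (\<lambda>i. knorm l (lam i)) at_top sequentially \<or>
        (\<exists>r x. strict_mono r \<and> (lam \<circ> r) \<longlonglongrightarrow> x)"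
begin

lemma tendsto_kernel:
  assumes "u \<longlonglongrightarrow> x" "v \<longlonglongrightarrow> y"
  shows "(\<lambda>i. l (u i) (v i)) \<longlonglongrightarrow> l x y"
proof -
  have "((\<lambda>i. (\<lambda>(z, w). l z w) (u i, v i)) \<longlongrightarrow> (\<lambda>(z, w). l z w) (x, y)) sequentially"
    using continuous assms
    by (intro continuous_on_tendsto_compose[OF continuous] tendsto_Pair) auto
  then show ?thesis by simp
qed

text \<open>Otherwise some subsequence converges to a point \<open>x\<close>, and by continuity the
  distances of its consecutive terms tend to \<open>kdist l x x = 0\<close>, against
  separation.\<close>

lemma weakly_separated_knorm_at_top:
  assumes "weakly_separated l lam"
  shows "filterlim (\<lambda>i. knorm l (lam i)) at_top sequentially"
proof (rule ccontr)
  assume "\<not> ?thesis"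
  then obtain r x where r: "strict_mono r" and u: "(lam \<circ> r) \<longlonglongrightarrow> x" using proper[of lam] by blast
  define v where "v = lam \<circ> r"
  have v: "v \<longlonglongrightarrow> x" "(\<lambda>i. v (Suc i)) \<longlonglongrightarrow> x"
    using u LIMSEQ_Suc[of v x] by (simp_all add: v_def)
  have k: "(\<lambda>i. knorm l (w i)) \<longlonglongrightarrow> knorm l x" if "w \<longlonglongrightarrow> x" for w
    unfolding knorm_def by (intro tendsto_intros tendsto_kernel that)
  have "(\<lambda>i. kdist l (v i) (v (Suc i))) \<longlonglongrightarrow> kdist l x x"
    unfolding kdist_def using knorm_pos[of x]
    by (intro tendsto_intros tendsto_kernel k v) auto
  then have lim: "(\<lambda>i. kdist l (v i) (v (Suc i))) \<longlonglongrightarrow> 0" by (simp add: kdist_self)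
  obtain \<epsilon> where "\<epsilon> > 0" and \<epsilon>: "\<And>i j. i \<noteq> j \<Longrightarrow> kdist l (lam i) (lam j) \<ge> \<epsilon>"
    using assms unfolding weakly_separated_def by blast
  have "kdist l (v i) (v (Suc i)) \<ge> \<epsilon>" for i
    unfolding v_def o_def using r by (intro \<epsilon>) (simp add: strict_mono_eq)
  then have "0 \<ge> \<epsilon>" by (intro LIMSEQ_le_const[OF lim]) auto
  then show False using \<open>\<epsilon> > 0\<close> by simp
qed

lemma gram_escaping:
  assumes "filterlim (\<lambda>i. knorm l (lam i)) at_top sequentially"
  shows "(\<lambda>i. gram (lam i) w) \<longlonglongrightarrow> 0"
proof -
  have "(\<lambda>i. l (lam i) w / complex_of_real (knorm l (lam i)) / complex_of_real (knorm l w)) \<longlonglongrightarrow> 0"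
    using tendsto_divide_zero[OF escaping[OF assms, of w]] .
  then show ?thesis by (simp add: gram_def)
qed

section \<open>Sparse unions of blocks as Riesz sequences\<close>

lemma eventually_gram_small:
  assumes \<mu>: "\<And>k. k \<in> K \<Longrightarrow> filterlim (\<lambda>j. knorm l (\<mu> k j)) at_top sequentially"
    and "finite K" "finite W" "e > 0"
  shows "\<forall>\<^sub>F j in sequentially. \<forall>k\<in>K. \<forall>w\<in>W. cmod (gram (\<mu> k j) w) \<le> e"
proof -
  have "\<forall>\<^sub>F j in sequentially. cmod (gram (\<mu> k j) w) \<le> e" if "k \<in> K" for k w
    using tendstoD[OF gram_escaping[OF \<mu>[OF that], of w] \<open>e > 0\<close>]
    by eventually_elim simp
  then show ?thesis using assms by (simp add: eventually_ball_finite_distrib)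
qed

text \<open>Greedy choice: each new block is taken so far out that it is nearly orthogonal to the
  finitely many points of the earlier blocks.\<close>

lemma sparse_subsequence:
  fixes e :: "nat \<Rightarrow> real"
  assumes \<mu>: "\<And>k. k \<in> K \<Longrightarrow> filterlim (\<lambda>j. knorm l (\<mu> k j)) at_top sequentially"
    and K: "finite K" and e: "\<And>j. e j > 0"
  obtains m :: "nat \<Rightarrow> nat" where "strict_mono m"
    "\<And>i j k k'. i < j \<Longrightarrow> k \<in> K \<Longrightarrow> k' \<in> K \<Longrightarrow> cmod (gram (\<mu> k (m j)) (\<mu> k' (m i))) \<le> e j"
proof -
  \<comment> \<open>All blocks of index up to \<open>a\<close> are collected, chosen or not, so that
    each choice needs to know only the preceding index.\<close>
  let ?W = "\<lambda>a. \<Union>i\<le>a. (\<lambda>k. \<mu> k i) ` K"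
  have "\<exists>m. \<forall>j. True \<and> (m j < m (Suc j) \<and>
      (\<forall>k\<in>K. \<forall>w\<in>?W (m j). cmod (gram (\<mu> k (m (Suc j))) w) \<le> e (Suc j)))"
  proof (rule dependent_nat_choice[where P = "\<lambda>_ _. True" and Q = "\<lambda>j a b. a < b \<and>
      (\<forall>k\<in>K. \<forall>w\<in>?W a. cmod (gram (\<mu> k b) w) \<le> e (Suc j))"])
    fix a j :: nat
    have "\<forall>\<^sub>F b in sequentially. \<forall>k\<in>K. \<forall>w\<in>?W a. cmod (gram (\<mu> k b) w) \<le> e (Suc j)"
      using K e by (intro eventually_gram_small \<mu>) auto
    then have "\<forall>\<^sub>F b in sequentially. a < b \<and> (\<forall>k\<in>K. \<forall>w\<in>?W a. cmod (gram (\<mu> k b) w) \<le> e (Suc j))"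
      using eventually_gt_at_top[of a] by eventually_elim blast
    then show "\<exists>b. True \<and> a < b \<and> (\<forall>k\<in>K. \<forall>w\<in>?W a. cmod (gram (\<mu> k b) w) \<le> e (Suc j))"
      using eventually_happens' sequentially_bot by blast
  qed simp
  then obtain m where step: "\<forall>j. True \<and> (m j < m (Suc j) \<and>
      (\<forall>k\<in>K. \<forall>w\<in>?W (m j). cmod (gram (\<mu> k (m (Suc j))) w) \<le> e (Suc j)))" ..
  have m: "strict_mono m" using step by (simp add: strict_mono_Suc_iff)
  show ?thesis
  proof (rule that[OF m])
    fix i j :: nat and k k' assume "i < j" and k: "k \<in> K" "k' \<in> K"
    then obtain j' where j': "j = Suc j'" "i \<le> j'" by (cases j) auto
    have "m i \<le> m j'" using j' m by (simp add: strict_mono_less_eq)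
    then have "\<mu> k' (m i) \<in> ?W (m j')" using k(2) by blast
    then show "cmod (gram (\<mu> k (m j)) (\<mu> k' (m i))) \<le> e j"
      using step k(1) unfolding j'(1) by blast
  qed
qed

text \<open>Along a sparse subsequence the interaction between blocks decays geometrically, so its
  total weight stays below half of the common lower bound of the blocks.\<close>

lemma interpolating_subsequence:
  fixes \<mu> :: "nat \<Rightarrow> nat \<Rightarrow> 'a"
  assumes \<mu>: "\<And>k. k \<in> {1..n} \<Longrightarrow> filterlim (\<lambda>j. knorm l (\<mu> k j)) at_top sequentially"
    and n: "n > 0" and "\<delta> > 0" and low: "\<And>j. gram_ge \<delta> ((\<lambda>k. \<mu> k j) ` {1..n})"
  obtains m :: "nat \<Rightarrow> nat" where "strict_mono m" "interpolating l (\<Union>j. \<Union>k\<in>{1..n}. {\<mu> k (m j)})"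
proof -
  \<comment> \<open>The square sum of the weights will be at most \<open>n * \<eta>\<close> times
    the geometric series with sum 4/3, that is \<open>\<delta> / 3\<close>, which is below
    \<open>\<delta> / 2\<close>.\<close>
  define \<eta> where "\<eta> = \<delta> / (4 * n)"
  have \<eta>: "\<eta> > 0" using \<open>\<delta> > 0\<close> n by (simp add: \<eta>_def)
  obtain m where m: "strict_mono m" and small:
    "\<And>i j k k'. i < j \<Longrightarrow> k \<in> {1..n} \<Longrightarrow> k' \<in> {1..n} \<Longrightarrow>
       cmod (gram (\<mu> k (m j)) (\<mu> k' (m i))) \<le> \<eta> * (1/4) ^ j"
    using sparse_subsequence[of "{1..n}" \<mu> "\<lambda>j. \<eta> * (1/4) ^ j", OF \<mu>] \<eta> by auto
  define S where "S j = (\<lambda>k. \<mu> k (m j)) ` {1..n}" for j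
  \<comment> \<open>The blocks may overlap; each point is assigned to the first block containing it.\<close>
  define h where "h x = (LEAST j. x \<in> S j)" for x
  \<comment> \<open>The decay \<open>(1/4) ^ j\<close> is shared between the two points of a pair:
    one factor \<open>(1/2) ^ j\<close> is kept and the other is relaxed to the smaller
    label.\<close>
  define c where "c x = sqrt \<eta> * (1/2) ^ h x" for x
  have hS: "x \<in> S (h x)" if "x \<in> (\<Union>j. S j)" for x
    using that LeastI[of "\<lambda>j. x \<in> S j"] unfolding h_def by blast
  have c: "c x \<ge> 0" for x using \<eta> by (simp add: c_def)
  have off1: "cmod (gram x y) \<le> c x * c y"
    if lt: "x \<in> (\<Union>j. S j)" "y \<in> (\<Union>j. S j)" "h y < h x" for x y
  proof -
    obtain k k' where k: "k \<in> {1..n}" "k' \<in> {1..n}" "\<mu> k (m (h x)) = x" "\<mu> k' (m (h y)) = y"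
      using hS[OF lt(1)] hS[OF lt(2)] unfolding S_def image_iff by metis
    have "cmod (gram x y) \<le> \<eta> * (1/4) ^ h x"
      using small[OF lt(3) k(1,2)] unfolding k(3,4) .
    also have "(1/4 :: real) ^ h x = (1/2) ^ h x * (1/2) ^ h x"
      by (simp flip: power_mult_distrib)
    also have "\<eta> * \<dots> \<le> \<eta> * ((1/2) ^ h x * (1/2) ^ h y)"
      using \<eta> lt(3) by (intro mult_left_mono power_decreasing) auto
    also have "\<dots> = c x * c y" using \<eta> by (simp add: c_def)
    finally show ?thesis .
  qed
  have off: "cmod (gram x y) \<le> c x * c y"
    if "x \<in> (\<Union>j. S j)" "y \<in> (\<Union>j. S j)" "h x \<noteq> h y" for x y
    using that off1[of x y] off1[of y x] by (metis cmod_gram_commute mult.commute linorder_neqE_nat)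
  \<comment> \<open>Half of \<delta> survives the perturbation from below. From above, blocks of at
    most \<open>n\<close> points contribute the factor \<open>n\<close> and the perturbation adds at
    most \<open>\<delta> / 2\<close>.\<close>
  have "\<delta> / 2 * (\<Sum>x\<in>F. (cmod (a x))\<^sup>2) \<le> (comb_norm l F a)\<^sup>2 \<and>
        (comb_norm l F a)\<^sup>2 \<le> (n + \<delta> / 2) * (\<Sum>x\<in>F. (cmod (a x))\<^sup>2)"
    if F: "finite F" "F \<subseteq> (\<Union>j. S j)" for F a
  proof -
    let ?B = "\<lambda>j. {x \<in> F. h x = j}" and ?s = "\<Sum>x\<in>F. (cmod (a x))\<^sup>2"
    have "?s \<ge> 0" by (simp add: sum_nonneg)
    have offF: "cmod (gram x y) \<le> c x * c y" if "x \<in> F" "y \<in> F" "h x \<noteq> h y" for x y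
      using off[OF subsetD[OF F(2)] subsetD[OF F(2)]] that by simp
    have B: "?B j \<subseteq> S j" for j using hS F by blast
    have cardB: "card (?B j) \<le> n" for j
    proof -
      have "card (?B j) \<le> card (S j)" using B by (intro card_mono) (auto simp: S_def)
      also have "\<dots> \<le> n" unfolding S_def using card_image_le[of "{1..n}"] by force
      finally show ?thesis .
    qed
    have "(\<Sum>x\<in>F. (c x)\<^sup>2) = (\<Sum>j\<in>h ` F. \<Sum>x\<in>?B j. (c x)\<^sup>2)"
      by (rule sum.image_gen[OF F(1)])
    also have "\<dots> = (\<Sum>j\<in>h ` F. card (?B j) * (\<eta> * (1/4) ^ j))"
    proof (rule sum.cong[OF refl])
      fix j
      have "(c x)\<^sup>2 = \<eta> * (1/4) ^ j" if "x \<in> ?B j" for x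
      proof -
        have "(c x)\<^sup>2 = (sqrt \<eta>)\<^sup>2 * ((1/2) ^ j)\<^sup>2"
          using that by (simp add: c_def power_mult_distrib)
        also have "((1/2 :: real) ^ j)\<^sup>2 = (1/4) ^ j"
          by (simp add: power2_eq_square flip: power_mult_distrib)
        finally show ?thesis using \<eta> by simp
      qed
      then show "(\<Sum>x\<in>?B j. (c x)\<^sup>2) = card (?B j) * (\<eta> * (1/4) ^ j)" by simp
    qed
    also have "\<dots> \<le> (\<Sum>j\<in>h ` F. n * (\<eta> * (1/4) ^ j))"
      using \<eta> cardB by (intro sum_mono mult_right_mono) auto
    also have "\<dots> = n * \<eta> * (\<Sum>j\<in>h ` F. (1/4) ^ j)" by (simp add: sum_distrib_left mult.assoc)
    also have "\<dots> \<le> n * \<eta> * (\<Sum>j. (1/4) ^ j)"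
      using F \<eta> by (intro mult_left_mono sum_le_suminf) (auto simp: summable_geometric)
    also have "\<dots> = n * \<eta> * (4/3)" by (simp add: suminf_geometric)
    also have "\<dots> \<le> \<delta> / 2" using n \<open>\<delta> > 0\<close> by (simp add: \<eta>_def)
    finally have cs: "(\<Sum>x\<in>F. (c x)\<^sup>2) \<le> \<delta> / 2" .
    have "\<delta> * (\<Sum>x\<in>?B j. (cmod (a x))\<^sup>2) \<le> (comb_norm l (?B j) a)\<^sup>2" for j
      using gram_ge_subset[OF low[of "m j"], of "?B j"] B unfolding S_def gram_ge_def by blast
    then have "(\<delta> - (\<Sum>x\<in>F. (c x)\<^sup>2)) * ?s \<le> (comb_norm l F a)\<^sup>2"
      by (intro comb_norm_sq_blocks_lower[where h = h] F(1) offF c)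
    moreover have "\<delta> / 2 * ?s \<le> (\<delta> - (\<Sum>x\<in>F. (c x)\<^sup>2)) * ?s"
      using cs \<open>?s \<ge> 0\<close> by (intro mult_right_mono) auto
    moreover have "(comb_norm l F a)\<^sup>2 \<le> (\<Sum>j\<in>h ` F. (comb_norm l (?B j) a)\<^sup>2) + (\<Sum>x\<in>F. (c x)\<^sup>2) * ?s"
      using comb_norm_sq_blocks[of F h c a, OF F(1) offF c] by (simp add: abs_le_iff)
    moreover have "(\<Sum>x\<in>F. (c x)\<^sup>2) * ?s \<le> \<delta> / 2 * ?s" using cs \<open>?s \<ge> 0\<close> by (rule mult_right_mono)
    moreover have "(\<Sum>j\<in>h ` F. (comb_norm l (?B j) a)\<^sup>2) \<le> n * ?s"
    proof -
      have "(comb_norm l (?B j) a)\<^sup>2 \<le> n * (\<Sum>x\<in>?B j. (cmod (a x))\<^sup>2)" for j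
      proof -
        have "(comb_norm l (?B j) a)\<^sup>2 \<le> card (?B j) * (\<Sum>x\<in>?B j. (cmod (a x))\<^sup>2)"
          using F by (intro comb_norm_sq_le_card) auto
        also have "\<dots> \<le> n * (\<Sum>x\<in>?B j. (cmod (a x))\<^sup>2)"
          using cardB by (intro mult_right_mono) (auto simp: sum_nonneg)
        finally show ?thesis .
      qed
      then have "(\<Sum>j\<in>h ` F. (comb_norm l (?B j) a)\<^sup>2) \<le> (\<Sum>j\<in>h ` F. n * (\<Sum>x\<in>?B j. (cmod (a x))\<^sup>2))"
        by (rule sum_mono)
      also have "\<dots> = n * ?s" unfolding sum_distrib_left by (rule sum.image_gen[OF F(1), symmetric])
      finally show ?thesis .
    qed
    ultimately show ?thesis by (auto simp: distrib_right)
  qed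
  moreover have "\<delta> / 2 > 0" "n + \<delta> / 2 > 0" using \<open>\<delta> > 0\<close> by auto
  ultimately have "interpolating l (\<Union>j. S j)" unfolding interpolating_def by blast
  moreover have "(\<Union>j. S j) = (\<Union>j. \<Union>k\<in>{1..n}. {\<mu> k (m j)})" unfolding S_def by blast
  ultimately show ?thesis using that m by simp
qed

section \<open>From interpolating subsequences to uniform lower bounds\<close>

text \<open>\<open>H\<close> is the interpolation condition for one \<open>n\<close>. Sets violating
  every uniform bound are split into a common part \<open>J\<close> and remainders
  \<open>D j\<close>; \<open>H\<close> is applied to the remainders only.\<close>

lemma interpolating_subsequences_imp_gram_ge:
  assumes H: "\<And>\<mu> :: nat \<Rightarrow> nat \<Rightarrow> 'a.
       (\<forall>k\<in>{1..n}. filterlim (\<lambda>j. knorm l (\<mu> k j)) at_top sequentially) \<Longrightarrow>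
       (\<exists>lam. weakly_separated l lam \<and> range lam = (\<Union>j. \<Union>k\<in>{1..n}. {\<mu> k j})) \<Longrightarrow>
       (\<exists>m::nat \<Rightarrow> nat. strict_mono m \<and> interpolating l (\<Union>j. \<Union>k\<in>{1..n}. {\<mu> k (m j)}))"
    and ws: "weakly_separated l lam" and n: "n > 0"
  shows "\<exists>\<delta>>0. \<forall>F. F \<subseteq> range lam \<longrightarrow> card F = n \<longrightarrow> gram_ge \<delta> F"
proof (rule ccontr)
  assume neg: "\<not> ?thesis"
  have "\<exists>F. F \<subseteq> range lam \<and> card F = n \<and> \<not> gram_ge (1 / Suc j) F" for j
  proof -
    have "1 / real (Suc j) > 0" by simp
    then show ?thesis using neg by blast
  qed
  then obtain F where F: "\<And>j. F j \<subseteq> range lam" "\<And>j. card (F j) = n"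
    and bad: "\<And>j. \<not> gram_ge (1 / Suc j) (F j)" by metis
  have finF: "finite (F j)" for j using F(2)[of j] n card_ge_0_finite by force
  \<comment> \<open>Along infinitely many \<open>j\<close> the sets \<open>F j\<close> share the points of \<open>J\<close>; by maximality of \<open>J\<close>
    every other point lies in only finitely many of these sets.\<close>
  define P where "P J \<longleftrightarrow> infinite {j. J \<subseteq> F j}" for J
  have P: "finite J \<and> card J \<le> n" if "P J" for J
  proof -
    have "{j. J \<subseteq> F j} \<noteq> {}" using that unfolding P_def by (rule infinite_imp_nonempty)
    then obtain j where "J \<subseteq> F j" by blast
    then show ?thesis using finite_subset[of J "F j"] card_mono[of "F j" J] finF[of j] F(2)[of j] by simp
  qed
  have "P {}" by (simp add: P_def)
  \<comment> \<open>A set of largest cardinality exists because \<open>P\<close> bounds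
    cardinalities by \<open>n\<close>.\<close>
  then have "\<exists>J. P J \<and> (\<forall>J'. P J' \<longrightarrow> card J' \<le> card J)"
    by (rule ex_has_greatest_nat[where b = "Suc n"]) (simp add: P le_imp_less_Suc)
  then obtain J where J: "P J" and maxJ: "\<And>J'. P J' \<Longrightarrow> card J' \<le> card J" by blast
  define r where "r = enumerate {j. J \<subseteq> F j}"
  have r: "strict_mono r" "\<And>j. J \<subseteq> F (r j)"
    using J strict_mono_enumerate enumerate_in_set[of "{j. J \<subseteq> F j}"] unfolding r_def P_def by auto
  define D where "D j = F (r j) - J" for j
  have JD: "F (r j) = J \<union> D j" "J \<inter> D j = {}" "finite (D j)" for j
    using r finF by (auto simp: D_def)
  \<comment> \<open>A point outside \<open>J\<close> lying in infinitely many \<open>D j\<close>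
    could be added to \<open>J\<close>, contradicting maximality.\<close>
  have escape: "\<forall>\<^sub>F j in sequentially. x \<notin> D j" for x
  proof (cases "x \<in> J")
    case False
    have "finite {j. x \<in> D j}"
    proof (rule ccontr)
      assume "infinite {j. x \<in> D j}"
      then have "infinite (r ` {j. x \<in> D j})"
        using r(1) by (simp add: finite_image_iff strict_mono_imp_inj_on)
      moreover have "r ` {j. x \<in> D j} \<subseteq> {j. insert x J \<subseteq> F j}"
        using r(2) by (auto simp: D_def)
      ultimately have "P (insert x J)" unfolding P_def using infinite_super by metis
      then show False using maxJ[of "insert x J"] False P[OF J] by simp
    qed
    then show ?thesis by (simp add: eventually_cofinite flip: cofinite_eq_sequentially)
  qed (simp add: D_def)
  \<comment> \<open>Since \<open>r j\<close> is at least \<open>j\<close>, a fixed \<delta>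
    eventually exceeds the constant \<open>1 / Suc (r j)\<close> for which the bound already
    fails.\<close>
  have bad': "\<forall>\<^sub>F j in sequentially. \<not> gram_ge \<delta> (F (r j))" if "\<delta> > 0" for \<delta>
  proof -
    have "\<forall>\<^sub>F j in sequentially. 1 / real (Suc j) < \<delta>"
      using order_tendstoD(2)[OF LIMSEQ_inverse_real_of_nat that] by (simp add: inverse_eq_divide)
    then show ?thesis
    proof eventually_elim
      case (elim j)
      have "1 / real (Suc (r j)) \<le> 1 / real (Suc j)"
        using seq_suble[OF r(1), of j] by (simp add: frac_le)
      then show ?case using elim bad[of "r j"] gram_ge_mono[of \<delta> "F (r j)" "1 / Suc (r j)"] by linarith
    qed
  qed
  obtain \<delta>0 where \<delta>0: "\<delta>0 > 0" "gram_ge \<delta>0 J"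
    using finite_lower_bound P[OF J] unfolding gram_ge_def by metis
  show False
  \<comment> \<open>If \<open>J\<close> exhausts the sets, \<open>F (r j)\<close> is constantly
    \<open>J\<close>, which has the bound \<open>\<delta>0\<close>. Otherwise every
    \<open>D j\<close> is nonempty and can be listed by \<open>{1..n}\<close> with
    repetitions.\<close>
  proof (cases "card J = n")
    case True
    then have "F (r j) = J" for j using card_subset_eq[OF finF r(2)] F(2) by metis
    then show False using bad'[OF \<delta>0(1)] \<delta>0(2) by simp
  next
    case False
    have "\<exists>f. f ` {1..n} = D j" for j
    proof (rule ex_image_atLeastAtMost[OF JD(3)])
      show "D j \<noteq> {}" using JD(1)[of j] F(2)[of "r j"] False by auto
      show "card (D j) \<le> n" using card_mono[OF finF, of "D j" "r j"] F(2)[of "r j"] by (auto simp: D_def)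
    qed
    then obtain f where f: "\<And>j. f j ` {1..n} = D j" by metis
    define \<mu> where "\<mu> k j = f j k" for k j :: nat
    have \<mu>D: "\<mu> k j \<in> D j" if "k \<in> {1..n}" for k j
      unfolding \<mu>_def f[of j, symmetric] using that by (rule imageI)
    have D\<mu>: "D j = (\<Union>k\<in>{1..n}. {\<mu> k j})" for j using f[of j] by (auto simp: \<mu>_def)
    \<comment> \<open>Only finitely many terms of \<open>lam\<close> have norm below
      \<open>Z\<close>, and each of them eventually leaves \<open>D j\<close>.\<close>
    have \<mu>: "filterlim (\<lambda>j. knorm l (\<mu> k j)) at_top sequentially" if k: "k \<in> {1..n}" for k
      unfolding filterlim_at_top
    proof
      fix Z
      have "\<forall>\<^sub>F i in sequentially. knorm l (lam i) \<ge> Z"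
        using weakly_separated_knorm_at_top[OF ws] by (simp add: filterlim_at_top)
      then have "finite {i. \<not> knorm l (lam i) \<ge> Z}"
        by (simp add: eventually_cofinite flip: cofinite_eq_sequentially)
      then have "\<forall>\<^sub>F j in sequentially. \<forall>i\<in>{i. \<not> knorm l (lam i) \<ge> Z}. lam i \<notin> D j"
        by (rule eventually_ball_finite) (use escape in blast)
      then show "\<forall>\<^sub>F j in sequentially. Z \<le> knorm l (\<mu> k j)"
      proof eventually_elim
        case (elim j)
        obtain i where "\<mu> k j = lam i" using \<mu>D[OF k, of j] F(1)[of "r j"] by (auto simp: D_def)
        then show ?case using elim \<mu>D[OF k, of j] by force
      qed
    qed
    let ?U = "\<Union>j. \<Union>k\<in>{1..n}. {\<mu> k j}"
    have subU: "?U \<subseteq> range lam" using F(1) D\<mu> by (fastforce simp: D_def)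
    \<comment> \<open>A finite union would eventually be disjoint from the nonempty sets
      \<open>D j\<close> that it contains.\<close>
    have infU: "infinite ?U"
    proof
      assume U: "finite ?U"
      have "\<forall>\<^sub>F j in sequentially. \<forall>x\<in>?U. x \<notin> D j"
        using U by (rule eventually_ball_finite) (use escape in blast)
      then obtain j where "\<forall>x\<in>?U. x \<notin> D j" using eventually_happens' sequentially_bot by blast
      then show False using \<mu>D[of 1 j] n by auto
    qed
    obtain lam' where "weakly_separated l lam'" "range lam' = ?U"
      by (rule weakly_separated_subset[OF ws infU subU])
    then have "\<exists>lam. weakly_separated l lam \<and> range lam = ?U" by blast
    with H[of \<mu>] \<mu> obtain m :: "nat \<Rightarrow> nat" where m: "strict_mono m" "interpolating l (\<Union>j. \<Union>k\<in>{1..n}. {\<mu> k (m j)})"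
      by metis
    from m(2) obtain A B where A: "A > 0" and AB: "\<forall>G a. finite G \<longrightarrow> G \<subseteq> (\<Union>j. \<Union>k\<in>{1..n}. {\<mu> k (m j)}) \<longrightarrow>
        A * (\<Sum>x\<in>G. (cmod (a x))\<^sup>2) \<le> (comb_norm l G a)\<^sup>2 \<and>
        (comb_norm l G a)\<^sup>2 \<le> B * (\<Sum>x\<in>G. (cmod (a x))\<^sup>2)"
      unfolding interpolating_def by (elim exE conjE) (rule that)
    have "gram_ge A (D (m j))" for j
      unfolding gram_ge_def using AB[rule_format, of "D (m j)"] JD(3)[of "m j"] D\<mu>[of "m j"] by blast
    then have AD: "gram_ge \<delta> (D (m j))" if "\<delta> \<le> A" for \<delta> j
      using that by (rule gram_ge_mono)
    define \<delta> where "\<delta> = min A \<delta>0"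
    have \<delta>: "\<delta> > 0" using A \<delta>0 by (simp add: \<delta>_def)
    have "\<forall>\<^sub>F j in sequentially. \<forall>k\<in>{1..n}. \<forall>w\<in>J. cmod (gram (\<mu> k j) w) \<le> \<delta> / (2 * n)"
      using \<delta> n P[OF J] by (intro eventually_gram_small \<mu>) auto
    then have "\<forall>\<^sub>F j in sequentially. \<forall>k\<in>{1..n}. \<forall>w\<in>J. cmod (gram (\<mu> k (m j)) w) \<le> \<delta> / (2 * n)"
      by (rule eventually_subseq[OF m(1)])
    \<comment> \<open>\<open>J\<close> and \<open>D (m j)\<close> share the bound \<delta> and
      become nearly orthogonal, so their union keeps \<open>\<delta> / 2\<close>, contrary to
      \<open>bad'\<close>.\<close>
    then have "\<forall>\<^sub>F j in sequentially. gram_ge (\<delta> / 2) (F (r (m j)))"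
    proof eventually_elim
      case (elim j)
      have "gram_ge \<delta> (D (m j))" "gram_ge \<delta> J"
        using AD gram_ge_mono[OF \<delta>0(2)] by (auto simp: \<delta>_def)
      moreover have "cmod (gram x w) \<le> \<delta> / (2 * n)" if "x \<in> D (m j)" "w \<in> J" for x w
        using elim that D\<mu>[of "m j"] by auto
      ultimately have "gram_ge (\<delta> / 2) (J \<union> D (m j))"
        using JD F(2)[of "r (m j)"] P[OF J] n \<delta> by (intro gram_ge_far_union[where n = n]) auto
      then show ?case by (simp add: JD(1))
    qed
    moreover have "\<forall>\<^sub>F j in sequentially. \<not> gram_ge (\<delta> / 2) (F (r (m j)))"
      by (rule eventually_subseq[OF m(1) bad']) (simp add: \<delta>)
    ultimately have "\<forall>\<^sub>F j in sequentially. False" by eventually_elim blast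
    then show False by simp
  qed
qed

text \<open>A set with fewer than \<open>n\<close> points is padded to exactly \<open>n\<close>
  points inside the infinite range; lower bounds pass to subsets.\<close>

lemma automatic_separation_imp_gram_ge:
  assumes "automatic_separation l" "weakly_separated l lam" "n \<ge> 3"
  obtains \<delta> where "\<delta> > 0" "\<And>F. F \<subseteq> range lam \<Longrightarrow> finite F \<Longrightarrow> card F \<le> n \<Longrightarrow> gram_ge \<delta> F"
proof -
  have "n_weakly_separated l n lam" using assms unfolding automatic_separation_def by blast
  then obtain \<delta> where \<delta>: "\<delta> > 0" "\<And>F. F \<subseteq> range lam \<Longrightarrow> card F = n \<Longrightarrow> gram_ge \<delta> F"
    using n_weakly_separated_iff_gram_ge[of n lam] assms(3) by auto
  have "gram_ge \<delta> F" if F: "F \<subseteq> range lam" "finite F" "card F \<le> n" for F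
  proof -
    have "infinite (range lam - F)"
      using weakly_separated_inj[OF assms(2)] F(2) by (simp add: finite_image_iff)
    then obtain E where E: "E \<subseteq> range lam - F" "finite E" "card E = n - card F"
      using infinite_arbitrarily_large by blast
    have "card (F \<union> E) = n" using E F by (subst card_Un_disjoint) auto
    then have "gram_ge \<delta> (F \<union> E)" using E(1) F(1) by (intro \<delta>(2)) auto
    then show ?thesis by (rule gram_ge_subset) (use E F in auto)
  qed
  then show ?thesis by (rule that[OF \<delta>(1)])
qed

end

section \<open>Equivalence of automatic separation and interpolating subsequences\<close>

theorem theorem5p13:
  fixes l :: "'a::topological_space \<Rightarrow> 'a \<Rightarrow> complex"
  assumes ker: "kernel l"
    and Q0: "\<And>F c. finite F \<Longrightarrow> (\<forall>z. (\<Sum>x\<in>F. c x * l z x) = 0) \<Longrightarrow> (\<forall>x\<in>F. c x = 0)"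
    and Q1: "continuous_on UNIV (\<lambda>(z, w). l z w)"
    and Q2: "\<And>lam. filterlim (\<lambda>i. knorm l (lam i)) at_top sequentially \<Longrightarrow>
               (\<forall>\<mu>. ((\<lambda>i. l (lam i) \<mu> / complex_of_real (knorm l (lam i))) \<longlongrightarrow> 0) sequentially)"
    and Q3: "\<And>lam::nat \<Rightarrow> 'a. filterlim (\<lambda>i. knorm l (lam i)) at_top sequentially \<or>
               (\<exists>r x. strict_mono r \<and> ((lam \<circ> r) \<longlongrightarrow> x) sequentially)"
  shows "automatic_separation l \<longleftrightarrow>
    (\<forall>n::nat. n \<ge> 3 \<longrightarrow> (\<forall>\<mu> :: nat \<Rightarrow> nat \<Rightarrow> 'a.
       (\<forall>k\<in>{1..n}. filterlim (\<lambda>j. knorm l (\<mu> k j)) at_top sequentially) \<longrightarrow>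
       (\<exists>lam. weakly_separated l lam \<and> range lam = (\<Union>j. \<Union>k\<in>{1..n}. {\<mu> k j})) \<longrightarrow>
       (\<exists>m::nat \<Rightarrow> nat. strict_mono m \<and> interpolating l (\<Union>j. \<Union>k\<in>{1..n}. {\<mu> k (m j)}))))"
  (is "_ \<longleftrightarrow> (\<forall>n\<ge>3. ?I n)")
proof -
  interpret proper_kernel l
  proof
    show "c x = 0" if "finite F" "\<forall>z. (\<Sum>x\<in>F. c x * l z x) = 0" "x \<in> F" for F c x
      using Q0[OF that(1,2)] that(3) by blast
    show "(\<lambda>i. l (lam i) \<mu> / complex_of_real (knorm l (lam i))) \<longlonglongrightarrow> 0"
      if "filterlim (\<lambda>i. knorm l (lam i)) at_top sequentially" for lam \<mu>
      using Q2[OF that] ..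
  qed (fact ker Q1 Q3)+
  show ?thesis
  proof
    assume sep: "automatic_separation l"
    show "\<forall>n\<ge>3. ?I n"
    proof (intro allI impI)
      fix n :: nat and \<mu> :: "nat \<Rightarrow> nat \<Rightarrow> 'a"
      assume n: "n \<ge> 3"
        and \<mu>: "\<forall>k\<in>{1..n}. filterlim (\<lambda>j. knorm l (\<mu> k j)) at_top sequentially"
        and "\<exists>lam. weakly_separated l lam \<and> range lam = (\<Union>j. \<Union>k\<in>{1..n}. {\<mu> k j})"
      then obtain lam where lam: "weakly_separated l lam" "range lam = (\<Union>j. \<Union>k\<in>{1..n}. {\<mu> k j})" by blast
      obtain \<delta> where \<delta>: "\<delta> > 0"
        "\<And>F. F \<subseteq> range lam \<Longrightarrow> finite F \<Longrightarrow> card F \<le> n \<Longrightarrow> gram_ge \<delta> F"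
        using automatic_separation_imp_gram_ge[OF sep lam(1) n] by blast
      \<comment> \<open>The points \<open>\<mu> k j\<close> may coincide for different
        \<open>k\<close>, so a block can have fewer than \<open>n\<close> elements; hence the bound
        for all cardinalities up to \<open>n\<close>.\<close>
      have low: "gram_ge \<delta> ((\<lambda>k. \<mu> k j) ` {1..n})" for j
        using lam(2) card_image_le[of "{1..n}" "\<lambda>k. \<mu> k j"] by (intro \<delta>(2)) auto
      show "\<exists>m::nat \<Rightarrow> nat. strict_mono m \<and> interpolating l (\<Union>j. \<Union>k\<in>{1..n}. {\<mu> k (m j)})"
      proof (rule interpolating_subsequence[OF _ _ \<delta>(1) low])
        show "filterlim (\<lambda>j. knorm l (\<mu> k j)) at_top sequentially" if "k \<in> {1..n}" for k
          using \<mu> that by (rule bspec)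
        show "n > 0" using n by simp
      qed blast
    qed
  next
    assume I: "\<forall>n\<ge>3. ?I n"
    have "n_weakly_separated l n lam" if "weakly_separated l lam" "n \<ge> 3" for n lam
      using interpolating_subsequences_imp_gram_ge[of n lam] I that
      by (simp add: n_weakly_separated_iff_gram_ge)
    then show "automatic_separation l" by (simp add: automatic_separation_def)
  qed
qed

end
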